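(* Let $G$ be a connected claw-free graph of order $n \ge 2$. Then (a) $\Psi_g^+(G) \ge \frac{1}{2}n$; and (b) if $G$ is not the path $P_3$ on three vertices, then $\Psi_g^-(G) \ge \frac{1}{2}n$.
   Context: All graphs are finite and simple. A graph is claw-free if it has no induced subgraph isomorphic to $K_{1,3}$. For a set $S$ of vertices of a graph $G$, a vertex $v \in S$ is an enclave of $S$ if $N[v] \subseteq S$; $S$ is enclaveless if it contains no enclave. The competition-enclaveless game on $G$ is played by Maximizer and Minimizer, who alternately choose a vertex $v$ not in the set $S$ of previously chosen vertices such that $S \cup \{v\}$ is enclaveless; the game ends when no such vertex exists. Maximizer aims to maximize and Minimizer to minimize the final $|S|$. $\Psi_g^+(G)$ is the final $|S|$ when Maximizer moves first and both play optimally; $\Psi_g^-(G)$ is the same when Minimizer moves first. *)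

theory Defs
  imports "Graph_Theory.Graph_Theory" Complex_Main
begin

text \<open>
  Finite simple graphs are the models of the locale \<open>graph\<close>: finite, loop-free, symmetric
  digraphs without parallel arcs. Adjacency of \<open>u\<close> and \<open>v\<close> is \<open>u \<rightarrow>\<^bsub>G\<^esub> v\<close>.
\<close>

definition claw_free :: "('a, 'b) pre_digraph \<Rightarrow> bool" where
  "claw_free G \<longleftrightarrow> \<not> (\<exists>H. induced_subgraph H G \<and> K\<^bsub>1,3\<^esub> H)"

definition path_graph :: "nat \<Rightarrow> nat pair_pre_digraph" where
  "path_graph n =
    \<lparr> pverts = {..<n}, parcs = {(i, j). i < n \<and> j < n \<and> (j = Suc i \<or> i = Suc j)} \<rparr>"

definition closed_nbhd :: "('a, 'b) pre_digraph \<Rightarrow> 'a \<Rightarrow> 'a set" where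
  "closed_nbhd G v = insert v {u. v \<rightarrow>\<^bsub>G\<^esub> u}"

definition enclave :: "('a, 'b) pre_digraph \<Rightarrow> 'a set \<Rightarrow> 'a \<Rightarrow> bool" where
  "enclave G S v \<longleftrightarrow> v \<in> S \<and> closed_nbhd G v \<subseteq> S"

definition enclaveless :: "('a, 'b) pre_digraph \<Rightarrow> 'a set \<Rightarrow> bool" where
  "enclaveless G S \<longleftrightarrow> \<not> (\<exists>v. enclave G S v)"

definition playable :: "('a, 'b) pre_digraph \<Rightarrow> 'a set \<Rightarrow> 'a set" where
  "playable G S = {v \<in> verts G - S. enclaveless G (insert v S)}"

datatype player = Maximizer | Minimizer

text \<open>
  \<open>game_value G p S\<close> is the final number of chosen vertices under optimal play when the vertices
  in \<open>S\<close> have been chosen and player \<open>p\<close> is to move. The value for an infinite vertex set is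
  a dummy that makes the recursion total.
\<close>

function game_value :: "('a, 'b) pre_digraph \<Rightarrow> player \<Rightarrow> 'a set \<Rightarrow> nat" where
  "game_value G p S =
    (if infinite (verts G) \<or> playable G S = {} then card S
     else case p of
       Maximizer \<Rightarrow> Max ((\<lambda>v. game_value G Minimizer (insert v S)) ` playable G S)
     | Minimizer \<Rightarrow> Min ((\<lambda>v. game_value G Maximizer (insert v S)) ` playable G S))"
  by pat_completeness auto
termination
proof (relation "measure (\<lambda>(G, p, S). card (verts G - S))", goal_cases)
  case 1
  show ?case by simp
next
  case (2 G p S v)
  then have "verts G - insert v S \<subset> verts G - S" "finite (verts G)"
    by (auto simp: playable_def)
  then show ?case by (simp add: psubset_card_mono del: Diff_insert)
next
  case (3 G p S v)
  then have "verts G - insert v S \<subset> verts G - S" "finite (verts G)"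
    by (auto simp: playable_def)
  then show ?case by (simp add: psubset_card_mono del: Diff_insert)
qed

declare game_value.simps [simp del]

definition Psi_plus :: "('a, 'b) pre_digraph \<Rightarrow> nat" (\<open>\<Psi>\<^sub>g\<^sup>+\<close>) where
  "\<Psi>\<^sub>g\<^sup>+ G = game_value G Maximizer {}"

definition Psi_minus :: "('a, 'b) pre_digraph \<Rightarrow> nat" (\<open>\<Psi>\<^sub>g\<^sup>-\<close>) where
  "\<Psi>\<^sub>g\<^sup>- G = game_value G Minimizer {}"

end

theory Submission
  imports Defs
begin

text \<open>
  A final position \<open>S\<close> is the complement of a minimal dominating set \<open>D\<close>. Vertices of \<open>D\<close> with a
  neighbour in \<open>D\<close> are matched to private neighbours in \<open>S\<close>. The remaining vertices of \<open>D\<close> form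
  an independent set \<open>I\<close>; if some \<open>x \<notin> I\<close> has at most one neighbour in \<open>I\<close>, sending each
  vertex of \<open>I\<close> to the next vertex on a geodesic towards \<open>x\<close> is injective, because a collision
  creates a claw. Hence \<open>|D| > |S|\<close> forces \<open>D\<close> to be independent and every vertex of \<open>S\<close> to have
  exactly two neighbours in \<open>D\<close>. So \<open>S\<close> contains no leaf of the graph, while counting edges between
  \<open>S\<close> and \<open>D\<close> yields two leaves. Maximizer therefore only has to play a leaf in his first move, which
  is possible unless both leaves are attached to Minimizer's opening vertex, and then the graph
  is \<open>P\<^sub>3\<close>.
\<close>

section \<open>Final positions and bounds on the value of the game\<close>

definition final_position :: "('a, 'b) pre_digraph \<Rightarrow> 'a set \<Rightarrow> bool" where
  "final_position G S \<longleftrightarrow> S \<subseteq> verts G \<and> enclaveless G S \<and> playable G S = {}"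

text \<open>Every play from \<open>S\<close> ends in a final position containing \<open>S\<close>.
  The recursion only takes maxima and minima over continuations, so a bound common to all these
  outcomes passes to the value, whoever is to move.\<close>

lemma game_value_ge:
  assumes "finite (verts G)" "S \<subseteq> verts G" "enclaveless G S"
    and "\<And>T. S \<subseteq> T \<Longrightarrow> final_position G T \<Longrightarrow> k \<le> card T"
  shows "k \<le> game_value G p S"
  using assms
proof (induction G p S rule: game_value.induct)
  case (1 G p S)
  show ?case
  proof (cases "playable G S = {}")
    case True
    then show ?thesis
      using 1 by (auto simp: game_value.simps[of G p S] final_position_def)
  next
    case False
    have fin: "finite (playable G S)"
      using "1.prems"(1) by (auto simp: playable_def)
    have step: "insert v S \<subseteq> verts G" "enclaveless G (insert v S)"
      "\<And>T. insert v S \<subseteq> T \<Longrightarrow> final_position G T \<Longrightarrow> k \<le> card T" if "v \<in> playable G S" for v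
      using that "1.prems" by (auto simp: playable_def)
    have no: "\<not> (infinite (verts G) \<or> playable G S = {})"
      using False "1.prems"(1) by blast
    show ?thesis
    proof (cases p)
      case Maximizer
      obtain v where v: "v \<in> playable G S"
        using False by blast
      have "k \<le> game_value G Minimizer (insert v S)"
        using "1.IH"(1)[OF no Maximizer v "1.prems"(1) step[OF v]] .
      then have "k \<le> Max ((\<lambda>v. game_value G Minimizer (insert v S)) ` playable G S)"
        using fin v by (meson Max_ge finite_imageI imageI le_trans)
      then show ?thesis
        using no Maximizer by (simp add: game_value.simps[of G Maximizer S])
    next
      case Minimizer
      have "k \<le> game_value G Maximizer (insert v S)" if v: "v \<in> playable G S" for v
        using "1.IH"(2)[OF no Minimizer v "1.prems"(1) step[OF v]] .
      then have "k \<le> Min ((\<lambda>v. game_value G Maximizer (insert v S)) ` playable G S)"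
        using fin False by simp
      then show ?thesis
        using no Minimizer by (simp add: game_value.simps[of G Minimizer S])
    qed
  qed
qed

lemma game_value_Maximizer_ge_move:
  assumes "finite (verts G)" "v \<in> playable G S"
  shows "game_value G Minimizer (insert v S) \<le> game_value G Maximizer S"
proof -
  have "finite (playable G S)"
    using assms(1) by (auto simp: playable_def)
  then show ?thesis
    using assms by (auto simp: game_value.simps[of G Maximizer S])
qed

section \<open>Claws, and shortest walks in connected claw-free graphs\<close>

text \<open>Turns the forbidden induced subgraph into a local rule: were the three neighbours
  pairwise nonadjacent, the four vertices would induce a claw with centre \<open>b\<close>.\<close>

lemma (in graph) claw_freeD:
  assumes "claw_free G" "b \<rightarrow>\<^bsub>G\<^esub> x" "b \<rightarrow>\<^bsub>G\<^esub> y" "b \<rightarrow>\<^bsub>G\<^esub> z" "x \<noteq> y" "x \<noteq> z" "y \<noteq> z"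
  shows "x \<rightarrow>\<^bsub>G\<^esub> y \<or> x \<rightarrow>\<^bsub>G\<^esub> z \<or> y \<rightarrow>\<^bsub>G\<^esub> z"
proof (rule ccontr)
  assume nadj: "\<not> ?thesis"
  let ?H = "G \<restriction> {b, x, y, z}"
  have ind: "induced_subgraph ?H G"
    using assms adj_in_verts by (intro induced_induce) blast
  have H: "graph ?H"
    using digraphI_induced[OF ind] induced_graph_imp_symmetric[OF sym_arcs ind] by (rule digraph.graphI)
  have sym: "\<And>u v. u \<rightarrow>\<^bsub>G\<^esub> v \<Longrightarrow> v \<rightarrow>\<^bsub>G\<^esub> u"
    by (rule arcs_ends_symmetric[OF sym_arcs])
  have ne: "b \<noteq> x" "b \<noteq> y" "b \<noteq> z"
    using assms adj_not_same by blast+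
  have "arcs_ends ?H = {(u, v). u \<rightarrow>\<^bsub>G\<^esub> v \<and> u \<in> {b, x, y, z} \<and> v \<in> {b, x, y, z}}"
    by (auto simp: arcs_ends_conv)
  also have "\<dots> = {b} \<times> {x, y, z} \<union> {x, y, z} \<times> {b}"
    using assms nadj sym adj_not_same by (auto simp: ne)
  finally have "arcs_ends ?H = {b} \<times> {x, y, z} \<union> {x, y, z} \<times> {b}" .
  moreover have "verts ?H = {b} \<union> {x, y, z}" "{b} \<inter> {x, y, z} = {}" "card {b} = 1" "card {x, y, z} = 3"
    using ne assms by auto
  ultimately have "K\<^bsub>1,3\<^esub> ?H"
    unfolding complete_bipartite_digraph_def using H by blast
  then show False
    using assms(1) ind unfolding claw_free_def by blast
qed

locale connected_claw_free_graph = graph +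
  assumes connected_graph: "Digraph_Component.connected G"
    and claw_free_graph: "claw_free G"
    and two_le_card: "2 \<le> card (verts G)"
begin

abbreviation nbhd :: "'a \<Rightarrow> 'a set" where
  "nbhd v \<equiv> {u. v \<rightarrow>\<^bsub>G\<^esub> u}"

lemma adj_sym: "u \<rightarrow>\<^bsub>G\<^esub> v \<Longrightarrow> v \<rightarrow>\<^bsub>G\<^esub> u"
  by (rule arcs_ends_symmetric[OF sym_arcs])

lemma adj_irrefl [simp]: "\<not> u \<rightarrow>\<^bsub>G\<^esub> u"
  using adj_not_same by blast

lemma no_claw:
  assumes "b \<rightarrow>\<^bsub>G\<^esub> x" "b \<rightarrow>\<^bsub>G\<^esub> y" "b \<rightarrow>\<^bsub>G\<^esub> z" "x \<noteq> y" "x \<noteq> z" "y \<noteq> z"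
  shows "x \<rightarrow>\<^bsub>G\<^esub> y \<or> x \<rightarrow>\<^bsub>G\<^esub> z \<or> y \<rightarrow>\<^bsub>G\<^esub> z"
  using claw_free_graph assms by (rule claw_freeD)

lemma finite_nbhd [simp]: "finite (nbhd v)"
  by (rule finite_subset[OF _ finite_verts]) (auto dest: adj_in_verts)

lemma all_reachable:
  assumes "u \<in> verts G" "v \<in> verts G"
  shows "u \<rightarrow>\<^sup>*\<^bsub>G\<^esub> v"
  using symmetric_connected_imp_strongly_connected[OF sym_arcs connected_graph] assms
  by (auto simp: strongly_connected_def)

lemma ex_adj:
  assumes "v \<in> verts G"
  obtains u where "v \<rightarrow>\<^bsub>G\<^esub> u"
proof -
  have "\<not> verts G \<subseteq> {v}"
    using two_le_card card_mono[of "{v}" "verts G"] by auto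
  then obtain w where "w \<in> verts G" "w \<noteq> v"
    by blast
  with all_reachable[OF assms] have "v \<rightarrow>\<^sup>*\<^bsub>G\<^esub> w" "v \<noteq> w"
    by auto
  then show thesis
    using that by (cases rule: converse_reachable_cases) auto
qed

text \<open>The graph distance from \<open>v\<close> to \<open>x\<close>. Between vertices the
  \<open>LEAST\<close> is attained, by connectedness.\<close>

definition steps_to :: "'a \<Rightarrow> 'a \<Rightarrow> nat" where
  "steps_to x v = (LEAST k. (v, x) \<in> arcs_ends G ^^ k)"

lemma steps_to_walk:
  assumes "x \<in> verts G" "v \<in> verts G"
  shows "(v, x) \<in> arcs_ends G ^^ steps_to x v"
proof -
  have "(v, x) \<in> (arcs_ends G)\<^sup>*"
    using all_reachable[OF assms(2,1)] by (rule reachable_rtranclI)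
  then obtain k where "(v, x) \<in> arcs_ends G ^^ k"
    by (auto simp: rtrancl_is_UN_relpow)
  then show ?thesis
    unfolding steps_to_def by (rule LeastI)
qed

lemma steps_to_adj:
  assumes "x \<in> verts G" "u \<rightarrow>\<^bsub>G\<^esub> v"
  shows "steps_to x u \<le> Suc (steps_to x v)"
proof -
  have "(u, x) \<in> arcs_ends G ^^ Suc (steps_to x v)"
    using assms(2) steps_to_walk[OF assms(1) adj_in_verts(2)[OF assms(2)]] by (rule relpow_Suc_I2)
  then show ?thesis
    unfolding steps_to_def[of x u] by (rule Least_le)
qed

lemma ex_step_closer:
  assumes "x \<in> verts G" "v \<in> verts G" "v \<noteq> x"
  shows "\<exists>u. v \<rightarrow>\<^bsub>G\<^esub> u \<and> steps_to x v = Suc (steps_to x u)"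
proof -
  have w: "(v, x) \<in> arcs_ends G ^^ steps_to x v"
    using assms by (intro steps_to_walk)
  with assms(3) obtain k where k: "steps_to x v = Suc k"
    by (cases "steps_to x v") auto
  with w obtain u where u: "v \<rightarrow>\<^bsub>G\<^esub> u" "(u, x) \<in> arcs_ends G ^^ k"
    by (metis relpow_Suc_E2)
  then have "steps_to x u \<le> k"
    unfolding steps_to_def by (intro Least_le)
  with u k steps_to_adj[OF assms(1) u(1)] show ?thesis
    by auto
qed

text \<open>\<open>f\<close> is the first step of a shortest walk towards \<open>x\<close>; its
  injectivity is where claw-freeness enters.\<close>

lemma independent_matching:
  assumes I: "I \<subseteq> verts G" "\<And>a a'. a \<in> I \<Longrightarrow> a' \<in> I \<Longrightarrow> \<not> a \<rightarrow>\<^bsub>G\<^esub> a'"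
    and x: "x \<in> verts G" "x \<notin> I"
    and one: "\<And>a a'. a \<in> I \<Longrightarrow> a' \<in> I \<Longrightarrow> x \<rightarrow>\<^bsub>G\<^esub> a \<Longrightarrow> x \<rightarrow>\<^bsub>G\<^esub> a' \<Longrightarrow> a = a'"
  obtains f where "inj_on f I" "\<And>a. a \<in> I \<Longrightarrow> a \<rightarrow>\<^bsub>G\<^esub> f a"
proof -
  have "\<forall>a\<in>I. \<exists>u. a \<rightarrow>\<^bsub>G\<^esub> u \<and> steps_to x a = Suc (steps_to x u)"
    using ex_step_closer[OF x(1)] I(1) x(2) by blast
  then obtain f where f: "\<And>a. a \<in> I \<Longrightarrow> a \<rightarrow>\<^bsub>G\<^esub> f a \<and> steps_to x a = Suc (steps_to x (f a))"
    by metis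
  have "inj_on f I"
  proof (rule inj_onI, rule ccontr)
    fix a a' assume a: "a \<in> I" "a' \<in> I" "f a = f a'" "a \<noteq> a'"
    define b where "b = f a"
    have b: "b \<rightarrow>\<^bsub>G\<^esub> a" "b \<rightarrow>\<^bsub>G\<^esub> a'" "steps_to x a = Suc (steps_to x b)" "steps_to x a' = Suc (steps_to x b)"
      using f[OF a(1)] f[OF a(2)] a(3) by (auto simp: b_def intro: adj_sym)
    \<comment> \<open>If \<open>b\<close> were \<open>x\<close>, then \<open>x\<close> would have
      two neighbours in \<open>I\<close>. So the walk continues beyond \<open>b\<close> to some
      \<open>c\<close>.\<close>
    then have "b \<noteq> x"
      using one[OF a(1,2)] a(4) by blast
    then obtain c where c: "b \<rightarrow>\<^bsub>G\<^esub> c" "steps_to x b = Suc (steps_to x c)"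
      using ex_step_closer[OF x(1)] adj_in_verts(1)[OF b(1)] by blast
    \<comment> \<open>The distances of \<open>a\<close> and \<open>a'\<close> to \<open>x\<close>
      exceed that of \<open>c\<close> by two, so \<open>b\<close> is the centre of a claw with
      leaves \<open>a\<close>, \<open>a'\<close>, \<open>c\<close>.\<close>
    have "\<not> a \<rightarrow>\<^bsub>G\<^esub> c" "\<not> a' \<rightarrow>\<^bsub>G\<^esub> c"
      using steps_to_adj[OF x(1), of a c] steps_to_adj[OF x(1), of a' c] b c by auto
    moreover have "a \<noteq> c" "a' \<noteq> c"
      using b c by auto
    ultimately show False
      using no_claw[OF b(1,2) c(1) a(4)] I(2)[OF a(1,2)] by blast
  qed
  with f show thesis
    using that by blast
qed

section \<open>The structure of final positions smaller than their complement\<close>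

text \<open>Adding \<open>d\<close> must create an enclave \<open>p\<close>. It is not
  \<open>d\<close>, which has a neighbour outside \<open>S\<close>. Since \<open>p\<close> was no
  enclave of \<open>S\<close> before, \<open>d\<close> is its only neighbour outside
  \<open>S\<close>.\<close>

lemma final_position_private:
  assumes "final_position G S" "d \<in> verts G" "d \<notin> S" "\<not> nbhd d \<subseteq> S"
  shows "\<exists>p\<in>S. nbhd p - S = {d}"
proof -
  have "\<not> enclaveless G (insert d S)"
    using assms by (auto simp: final_position_def playable_def)
  then obtain p where p: "p \<in> insert d S" "closed_nbhd G p \<subseteq> insert d S"
    by (auto simp: enclaveless_def enclave_def)
  have "p \<noteq> d"
    using p(2) assms(4) by (auto simp: closed_nbhd_def)
  with p have "p \<in> S" "nbhd p \<subseteq> insert d S"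
    by (auto simp: closed_nbhd_def)
  moreover have "\<not> nbhd p \<subseteq> S"
    using \<open>p \<in> S\<close> assms(1) by (auto simp: final_position_def enclaveless_def enclave_def closed_nbhd_def)
  ultimately show ?thesis
    by blast
qed

lemma small_final_position:
  assumes S: "final_position G S" and small: "card S < card (verts G - S)"
  shows "\<And>a. a \<in> verts G - S \<Longrightarrow> nbhd a \<subseteq> S"
    and "\<And>s. s \<in> S \<Longrightarrow> card (nbhd s - S) = 2"
proof -
  \<comment> \<open>\<open>I\<close> collects the vertices isolated within the complement of
    \<open>S\<close>; those in \<open>D'\<close> have a neighbour in the complement and hence a
    private neighbour in \<open>S\<close>.\<close>
  define I where "I = {d \<in> verts G - S. nbhd d \<subseteq> S}"
  define D' where "D' = verts G - S - I"
  have finS: "finite S" and SV: "S \<subseteq> verts G"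
    using S finite_subset[OF _ finite_verts] by (auto simp: final_position_def)
  have I: "I \<subseteq> verts G" "\<And>a a'. a \<in> I \<Longrightarrow> a' \<in> I \<Longrightarrow> \<not> a \<rightarrow>\<^bsub>G\<^esub> a'"
    by (auto simp: I_def)
  have "\<forall>d\<in>D'. \<exists>p\<in>S. nbhd p - S = {d}"
    using final_position_private[OF S] by (auto simp: D'_def I_def)
  then obtain p where p: "\<And>d. d \<in> D' \<Longrightarrow> p d \<in> S \<and> nbhd (p d) - S = {d}"
    by metis
  \<comment> \<open>Otherwise \<open>f\<close> on \<open>I\<close> and \<open>p\<close> on
    \<open>D'\<close> together embed the complement of \<open>S\<close> into \<open>S\<close>,
    against \<open>small\<close>.\<close>
  have two: "\<exists>a a'. a \<in> I \<and> a' \<in> I \<and> x \<rightarrow>\<^bsub>G\<^esub> a \<and> x \<rightarrow>\<^bsub>G\<^esub> a' \<and> a \<noteq> a'"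
    if x: "x \<in> verts G" "x \<notin> I" for x
  proof (rule ccontr)
    assume "\<not> ?thesis"
    with independent_matching[OF I x]
    obtain f where f: "inj_on f I" "\<And>a. a \<in> I \<Longrightarrow> a \<rightarrow>\<^bsub>G\<^esub> f a"
      by blast
    have "inj_on p D'"
      using p by (intro inj_onI) (metis singleton_inject)
    \<comment> \<open>The only neighbour of \<open>p d\<close> outside \<open>S\<close> is
      \<open>d\<close>, which is not in \<open>I\<close>, whereas \<open>f a\<close> has the
      neighbour \<open>a\<close> in \<open>I\<close>.\<close>
    moreover have disj: "f a \<noteq> p d" if "a \<in> I" "d \<in> D'" for a d
    proof
      assume "f a = p d"
      then have "a \<in> nbhd (p d) - S"
        using f(2)[OF that(1)] that(1) by (auto simp: I_def intro: adj_sym)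
      then show False
        using p[OF that(2)] that by (auto simp: D'_def)
    qed
    moreover have "f ` I \<subseteq> S" "p ` D' \<subseteq> S"
      using f p by (auto simp: I_def)
    ultimately have "card I + card D' \<le> card S"
      using f(1) card_Un_disjoint[of "f ` I" "p ` D'"] card_mono[of S "f ` I \<union> p ` D'"] finS
      by (force simp: card_image finite_subset)
    moreover have "card (verts G - S) = card I + card D'"
      using card_Un_disjoint[of I D'] by (simp add: D'_def I_def Un_Diff_cancel Un_absorb1 subset_iff)
    ultimately show False
      using small by simp
  qed
  have D': "D' = {}"
  proof (rule ccontr)
    assume "D' \<noteq> {}"
    then obtain x where x: "x \<in> verts G" "x \<notin> S" "x \<notin> I"
      by (auto simp: D'_def)
    then obtain a where "a \<in> I" "x \<rightarrow>\<^bsub>G\<^esub> a"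
      using two by blast
    then show False
      using x(2) adj_sym by (auto simp: I_def)
  qed
  then have I_eq: "I = verts G - S"
    by (auto simp: D'_def I_def)
  then show "nbhd a \<subseteq> S" if "a \<in> verts G - S" for a
    using that by (auto simp: I_def)
  show "card (nbhd s - S) = 2" if s: "s \<in> S" for s
  proof -
    obtain a a' where a: "a \<in> I" "a' \<in> I" "s \<rightarrow>\<^bsub>G\<^esub> a" "s \<rightarrow>\<^bsub>G\<^esub> a'" "a \<noteq> a'"
      using two[of s] s SV I_eq by blast
    have "nbhd s - S = {a, a'}"
    proof (intro equalityI subsetI)
      fix c assume "c \<in> nbhd s - S"
      then have c: "s \<rightarrow>\<^bsub>G\<^esub> c" "c \<in> I"
        using I_eq adj_in_verts by auto
      \<comment> \<open>A third neighbour in the independent set \<open>I\<close> would complete a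
        claw at \<open>s\<close>.\<close>
      then show "c \<in> {a, a'}"
        using no_claw[OF a(3,4) c(1) a(5)] I(2) a by blast
    qed (use a I_eq in auto)
    with a(5) show ?thesis
      by simp
  qed
qed

lemma leaf_not_in_small_final_position:
  assumes "final_position G S" "card S < card (verts G - S)" "card (nbhd u) = 1"
  shows "u \<notin> S"
proof
  assume "u \<in> S"
  then have "card (nbhd u - S) = 2"
    using small_final_position(2)[OF assms(1,2)] by blast
  moreover have "card (nbhd u - S) \<le> card (nbhd u)"
    by (intro card_mono) auto
  ultimately show False
    using assms(3) by simp
qed

text \<open>Double counting of the edges between \<open>D\<close> and \<open>S\<close>: every vertex
  of \<open>S\<close> contributes two, while a vertex of \<open>D\<close> contributes at least two
  unless it is a leaf.\<close>

lemma small_final_position_two_leaves: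
  assumes S: "final_position G S" "card S < card (verts G - S)"
  obtains u u' where "u \<in> verts G" "u' \<in> verts G" "u \<noteq> u'" "card (nbhd u) = 1" "card (nbhd u') = 1"
proof -
  define D where "D = verts G - S"
  define L where "L = {u \<in> D. card (nbhd u) = 1}"
  have fin: "finite D" "finite S"
    using S finite_subset[OF _ finite_verts] by (auto simp: D_def final_position_def)
  have nbhd_D: "nbhd d = {s \<in> S. d \<rightarrow>\<^bsub>G\<^esub> s}" if "d \<in> D" for d
    using small_final_position(1)[OF S] that by (auto simp: D_def)
  have "2 \<le> card (nbhd d) + (if d \<in> L then 1 else 0)" if d: "d \<in> D" for d
  proof -
    obtain w where "d \<rightarrow>\<^bsub>G\<^esub> w"
      using ex_adj[of d] d by (auto simp: D_def)
    then have "card (nbhd d) \<noteq> 0"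
      by auto
    then have "2 \<le> card (nbhd d) \<or> card (nbhd d) = 1"
      by linarith
    then show ?thesis
      using d by (auto simp: L_def)
  qed
  then have "(\<Sum>d\<in>D. 2) \<le> (\<Sum>d\<in>D. card (nbhd d) + (if d \<in> L then 1 else 0))"
    by (rule sum_mono)
  also have "\<dots> = (\<Sum>d\<in>D. card (nbhd d)) + card L"
    using fin by (simp add: sum.distrib sum.If_cases L_def Int_def)
  also have "(\<Sum>d\<in>D. card (nbhd d)) = (\<Sum>d\<in>D. card {s \<in> S. d \<rightarrow>\<^bsub>G\<^esub> s})"
    by (intro sum.cong refl) (simp only: nbhd_D)
  also have "\<dots> = 2 * card S"
  proof (rule sum_multicount[OF fin])
    show "\<forall>s\<in>S. card {d \<in> D. d \<rightarrow>\<^bsub>G\<^esub> s} = 2"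
    proof
      fix s assume "s \<in> S"
      moreover have "{d \<in> D. d \<rightarrow>\<^bsub>G\<^esub> s} = nbhd s - S"
        using adj_sym adj_in_verts by (auto simp: D_def)
      ultimately show "card {d \<in> D. d \<rightarrow>\<^bsub>G\<^esub> s} = 2"
        using small_final_position(2)[OF S] by simp
    qed
  qed
  \<comment> \<open>From \<open>2 * card D \<le> 2 * card S + card L\<close> and
    \<open>card S < card D\<close>: a deficit of one vertex costs two edges, hence two
    leaves.\<close>
  finally have "2 \<le> card L"
    using S(2) by (simp add: D_def)
  then obtain u u' where "u \<in> L" "u' \<in> L" "u \<noteq> u'"
    by (auto simp: card_le_Suc_iff numeral_2_eq_2)
  then show thesis
    using that by (auto simp: L_def D_def)
qed

section \<open>Two leaves with a common neighbour\<close>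

text \<open>A third neighbour of \<open>v\<close> would form a claw with the two leaves, whose only
  neighbour is \<open>v\<close>. Connectedness then leaves no other vertices.\<close>

lemma common_neighbour_of_leaves_imp_P3:
  assumes u: "card (nbhd u) = 1" "card (nbhd u') = 1" "u \<noteq> u'" "v \<rightarrow>\<^bsub>G\<^esub> u" "v \<rightarrow>\<^bsub>G\<^esub> u'"
  shows "digraph_iso G (with_proj (path_graph 3))"
proof -
  have adj_u: "u \<rightarrow>\<^bsub>G\<^esub> w \<longleftrightarrow> w = v" "u' \<rightarrow>\<^bsub>G\<^esub> w \<longleftrightarrow> w = v" for w
    using u(1,2) adj_sym[OF u(4)] adj_sym[OF u(5)]
    by (metis card_1_singletonE mem_Collect_eq singletonD)+
  have ne: "v \<noteq> u" "v \<noteq> u'"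
    using u by auto
  have adj_v: "v \<rightarrow>\<^bsub>G\<^esub> c \<longleftrightarrow> c = u \<or> c = u'" for c
  proof
    assume c: "v \<rightarrow>\<^bsub>G\<^esub> c"
    then have "c \<noteq> v" by auto
    then have "\<not> u \<rightarrow>\<^bsub>G\<^esub> c" "\<not> u' \<rightarrow>\<^bsub>G\<^esub> c" "\<not> u \<rightarrow>\<^bsub>G\<^esub> u'"
      using adj_u ne by auto
    then show "c = u \<or> c = u'"
      using no_claw[OF u(4,5) c u(3)] by blast
  qed (use u in auto)
  have verts: "verts G = {u, v, u'}"
  proof (intro equalityI subsetI)
    fix w assume "w \<in> verts G"
    then have "v \<rightarrow>\<^sup>*\<^bsub>G\<^esub> w"
      using all_reachable adj_in_verts(1)[OF u(4)] by blast
    \<comment> \<open>These three vertices are closed under adjacency.\<close>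
    then show "w \<in> {u, v, u'}"
      by (induction rule: reachable_induct) (use adj_u adj_v in blast)+
  qed (use u adj_in_verts in blast)
  have ends: "arcs_ends G = {(u, v), (v, u), (v, u'), (u', v)}"
  proof (intro equalityI subrelI)
    fix x y assume xy: "x \<rightarrow>\<^bsub>G\<^esub> y"
    then have "x \<in> {u, v, u'}"
      using adj_in_verts(1) verts by blast
    with xy show "(x, y) \<in> {(u, v), (v, u), (v, u'), (u', v)}"
      using adj_u adj_v by auto
  qed (use adj_u adj_v in auto)
  define g where "g w = (if w = u then 0 else if w = v then 1 else 2 :: nat)" for w
  \<comment> \<open>Arcs of the path are pairs of numbers, so each arc of \<open>G\<close> goes to
    the pair of images of its ends; this is injective because \<open>G\<close> has no parallel
    arcs.\<close>
  define h where "h = \<lparr>iso_verts = g, iso_arcs = map_prod g g \<circ> arc_to_ends G, iso_head = snd, iso_tail = fst\<rparr>"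
  have g: "inj_on g (verts G)"
    using u(3) ne by (auto simp: g_def verts inj_on_def)
  have "inj_on (map_prod g g) (arc_to_ends G ` arcs G)"
    by (rule inj_on_subset[OF map_prod_inj_on[OF g g]]) (auto simp: arc_to_ends_def)
  then have "inj_on (map_prod g g \<circ> arc_to_ends G) (arcs G)"
    by (intro comp_inj_on inj_on_arc_to_ends)
  then have "digraph_isomorphism h"
    using g wf_digraph by (auto simp: digraph_isomorphism_def h_def arc_to_ends_def)
  moreover have "with_proj (path_graph 3) = app_iso h G"
  proof -
    have gv: "g u = 0" "g v = 1" "g u' = 2"
      using u(3) ne by (auto simp: g_def)
    have "iso_arcs h ` arcs G = map_prod g g ` arcs_ends G"
      by (simp add: h_def image_comp arcs_ends_def)
    also have "\<dots> = {(0, 1), (1, 0), (1, 2), (2, 1)}"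
      by (auto simp: ends gv)
    also have "\<dots> = parcs (path_graph 3)"
      by (auto simp: path_graph_def)
    finally have "iso_arcs h ` arcs G = parcs (path_graph 3)" .
    moreover have "iso_verts h ` verts G = pverts (path_graph 3)"
      by (auto simp: h_def verts gv path_graph_def)
    ultimately show ?thesis
      by (simp add: app_iso_def with_proj_def h_def)
  qed
  ultimately show ?thesis
    unfolding digraph_iso_def by blast
qed

section \<open>Leaves as opening moves\<close>

lemma card_complement:
  assumes "final_position G S"
  shows "card (verts G - S) = card (verts G) - card S" "card S \<le> card (verts G)"
  using assms finite_subset[of S "verts G"]
  by (auto simp: final_position_def card_Diff_subset intro: card_mono)

text \<open>A chosen leaf stays chosen, so no small final position can be reached any more.\<close>

lemma game_value_ge_half_of_leaf:
  assumes "S \<subseteq> verts G" "enclaveless G S" "u \<in> S" "card (nbhd u) = 1"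
  shows "card (verts G) \<le> 2 * game_value G p S"
proof -
  \<comment> \<open>Half the order, rounded up: the bound as a natural number.\<close>
  have "(card (verts G) + 1) div 2 \<le> game_value G p S"
  proof (rule game_value_ge[OF finite_verts assms(1,2)])
    fix T assume T: "S \<subseteq> T" "final_position G T"
    then show "(card (verts G) + 1) div 2 \<le> card T"
      using leaf_not_in_small_final_position[OF T(2) _ assms(4)] assms(3) card_complement[OF T(2)]
      by fastforce
  qed
  then show ?thesis
    by linarith
qed

lemma enclaveless_singleton:
  assumes "v \<in> verts G"
  shows "enclaveless G {v}"
proof -
  obtain w where "v \<rightarrow>\<^bsub>G\<^esub> w"
    using ex_adj[OF assms] .
  then show ?thesis
    by (auto simp: enclaveless_def enclave_def closed_nbhd_def)
qed

text \<open>Makes a leaf \<open>u\<close> a legal reply to the opening \<open>v\<close>: each of the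
  two vertices has a neighbour outside the pair.\<close>

lemma enclaveless_nonadjacent_pair:
  assumes "u \<in> verts G" "v \<in> verts G" "\<not> v \<rightarrow>\<^bsub>G\<^esub> u"
  shows "enclaveless G {u, v}"
proof -
  obtain w w' where w: "u \<rightarrow>\<^bsub>G\<^esub> w" "v \<rightarrow>\<^bsub>G\<^esub> w'"
    using ex_adj assms(1,2) by metis
  have "\<not> u \<rightarrow>\<^bsub>G\<^esub> v"
    using assms(3) adj_sym by blast
  then have "w \<notin> {u, v}" "w' \<notin> {u, v}"
    using w assms(3) by auto
  then show ?thesis
    using w unfolding enclaveless_def enclave_def closed_nbhd_def by blast
qed

text \<open>Either no final position is small, or there are two leaves; the last hypothesis ensures
  that one of them is already chosen or can be chosen now.\<close>

lemma Maximizer_to_move_ge_half: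
  assumes "S \<subseteq> verts G" "enclaveless G S"
    and "\<And>u u'. u \<in> verts G \<Longrightarrow> u' \<in> verts G \<Longrightarrow> u \<noteq> u' \<Longrightarrow> card (nbhd u) = 1 \<Longrightarrow> card (nbhd u') = 1
      \<Longrightarrow> u \<in> playable G S \<or> u' \<in> playable G S \<or> u \<in> S \<or> u' \<in> S"
  shows "card (verts G) \<le> 2 * game_value G Maximizer S"
proof (cases "\<exists>T. final_position G T \<and> card T < card (verts G - T)")
  case True
  then obtain u u' where u: "u \<in> verts G" "u' \<in> verts G" "u \<noteq> u'" "card (nbhd u) = 1" "card (nbhd u') = 1"
    using small_final_position_two_leaves by metis
  then consider "u \<in> S \<or> u' \<in> S" | w where "w \<in> playable G S" "card (nbhd w) = 1"
    using assms(3) by blast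
  then show ?thesis
  proof cases
    case 1
    then show ?thesis
      using game_value_ge_half_of_leaf[OF assms(1,2)] u by blast
  next
    case 2
    then have "insert w S \<subseteq> verts G" "enclaveless G (insert w S)"
      using assms(1) by (auto simp: playable_def)
    then have "card (verts G) \<le> 2 * game_value G Minimizer (insert w S)"
      using game_value_ge_half_of_leaf 2(2) by blast
    also have "\<dots> \<le> 2 * game_value G Maximizer S"
      using game_value_Maximizer_ge_move[OF finite_verts 2(1)] by simp
    finally show ?thesis .
  qed
next
  case False
  have "(card (verts G) + 1) div 2 \<le> game_value G Maximizer S"
  proof (rule game_value_ge[OF finite_verts assms(1,2)])
    fix T assume "S \<subseteq> T" and T: "final_position G T"
    show "(card (verts G) + 1) div 2 \<le> card T"
      using False T card_complement[OF T] by fastforce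
  qed
  then show ?thesis
    by linarith
qed

lemma Psi_plus_ge_half: "card (verts G) \<le> 2 * \<Psi>\<^sub>g\<^sup>+ G"
  unfolding Psi_plus_def
  by (rule Maximizer_to_move_ge_half)
    (auto simp: playable_def enclaveless_singleton, simp add: enclaveless_def enclave_def)

lemma Psi_minus_ge_half:
  assumes "\<not> digraph_iso G (with_proj (path_graph 3))"
  shows "card (verts G) \<le> 2 * \<Psi>\<^sub>g\<^sup>- G"
proof -
  have half: "card (verts G) \<le> 2 * game_value G Maximizer {v}" if v: "v \<in> verts G" for v
  proof (rule Maximizer_to_move_ge_half)
    fix u u' assume u: "u \<in> verts G" "u' \<in> verts G" "u \<noteq> u'" "card (nbhd u) = 1" "card (nbhd u') = 1"
    \<comment> \<open>A leaf not adjacent to \<open>v\<close> is either a legal reply or the opening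
      vertex \<open>v\<close> itself.\<close>
    then have "\<not> v \<rightarrow>\<^bsub>G\<^esub> u \<or> \<not> v \<rightarrow>\<^bsub>G\<^esub> u'"
      using common_neighbour_of_leaves_imp_P3 assms by blast
    then show "u \<in> playable G {v} \<or> u' \<in> playable G {v} \<or> u \<in> {v} \<or> u' \<in> {v}"
      using enclaveless_nonadjacent_pair[OF u(1) v] enclaveless_nonadjacent_pair[OF u(2) v] u(1,2)
      by (auto simp: playable_def)
  qed (use v enclaveless_singleton in auto)
  have playable: "playable G {} = verts G"
    by (auto simp: playable_def enclaveless_singleton)
  moreover have "verts G \<noteq> {}"
    using two_le_card by auto
  ultimately have "\<Psi>\<^sub>g\<^sup>- G = Min ((\<lambda>v. game_value G Maximizer {v}) ` verts G)"
    by (simp add: Psi_minus_def game_value.simps[of G Minimizer "{}"])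
  moreover have "\<dots> \<in> (\<lambda>v. game_value G Maximizer {v}) ` verts G"
    using \<open>verts G \<noteq> {}\<close> by (intro Min_in) auto
  ultimately show ?thesis
    using half by auto
qed

end

theorem theorem5p10:
  fixes G :: "('a, 'b) pre_digraph" and n :: nat
  assumes "graph G"
    and "Digraph_Component.connected G"
    and "claw_free G"
    and "card (verts G) = n"
    and "n \<ge> 2"
  shows "real (\<Psi>\<^sub>g\<^sup>+ G) \<ge> 1 / 2 * real n
    \<and> (\<not> digraph_iso G (with_proj (path_graph 3)) \<longrightarrow> real (\<Psi>\<^sub>g\<^sup>- G) \<ge> 1 / 2 * real n)"
proof -
  interpret connected_claw_free_graph G
    using assms by (intro connected_claw_free_graph.intro connected_claw_free_graph_axioms.intro) auto
  show ?thesis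
    using Psi_plus_ge_half Psi_minus_ge_half assms(4) by fastforce
qed

end
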